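(* Let $F:\mathbb{R}^n\to\mathbb{R}^n$ be continuously differentiable, $G:\mathbb{R}^n\to\mathbb{R}^s$ twice continuously differentiable, and $D\subseteq\mathbb{R}^s$ a convex polyhedral set. Suppose that $\bar x$ solves $0\in F(x)+\nabla G(x)N_D(G(x))$, that $(\bar x,G(\bar x))$ is nondegenerate with modulus $\tilde\gamma>0$, and let $\omega>0$ be the radius described in the context. Then both the mapping $S(\cdot)$ given by $$S(x)=\{u\mid 0\in u+F(x)+\nabla G(x)N_D(G(x)+G'(x)u)\},\quad x\in\mathbb B_\omega(\bar x),$$ and the multiplier mapping $\Lambda(\cdot)$ (which are single-valued on $\mathbb B_\omega(\bar x)$) are Lipschitz continuous in $\mathbb B_\omega(\bar x)$. Moreover, $S(\cdot)$ is G-semismooth in $\operatorname{int}\mathbb B_\omega(\bar x)$, i.e., at every point of it.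
   Context: $G'(x)$ is the Jacobian and $\nabla G(x)=G'(x)^\top$ its adjoint; $N_D$ is the normal cone of convex analysis; $\mathbb B_\omega(\bar x)$ is the closed ball. $\mathcal L_\lambda(x):=F(x)+\nabla G(x)\lambda$. A pair $(x,d)$ is nondegenerate with modulus $\gamma>0$ if $\|\nabla G(x)\lambda\|\ge\gamma\|\lambda\|$ for all $\lambda\in\operatorname{span}N_D(d)$. Under the nondegeneracy assumption there is a unique $\bar\lambda\in N_D(G(\bar x))$ with $\mathcal L_{\bar\lambda}(\bar x)=0$. Radius $\omega$. Under the nondegeneracy assumption there exist $\omega>0$ and constants $\beta,\beta_u,\beta_\lambda>0$ such that for all $x\in\mathbb B_\omega(\bar x)$: the problem $\min_u\{\frac12\|u\|^2+\langle F(x),u\rangle\mid G(x)+G'(x)u\in D\}$ has a unique solution $\hat u$, with multiplier $\hat\lambda\in N_D(G(x)+G'(x)\hat u)$ satisfying $\hat u+F(x)+\nabla G(x)\hat\lambda=0$; with $\hat d:=G(x)+G'(x)\hat u$ one has $\|\hat u\|\le\beta_u\|x-\bar x\|$, $\|((x;\hat d);(\mathcal L_{\hat\lambda}(x);G(x)-\hat d))-((\bar x;G(\bar x));(0;0))\|\le\beta\|x-\bar x\|$, $\|\hat\lambda-\bar\lambda\|\le\beta_\lambda\|x-\bar x\|$; $(x,\hat d)$ is nondegenerate with modulus $\tilde\gamma/2$; and $N_D(\hat d)\subseteq N_D(G(\bar x))$. Fix such an $\omega$. Then $S(x)=\hat u$, and $\Lambda(x):=\hat\lambda$. G-semismoothness.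 A continuous $H:\Omega\to\mathcal Y$ ($\Omega$ open in $\mathcal X$) is G-semismooth at $x\in\Omega$ with respect to a set-valued map $\mathcal T:\Omega\rightrightarrows\mathbb L(\mathcal X,\mathcal Y)$ if for any $h\to0$ and $V\in\mathcal T(x+h)$, $H(x+h)-H(x)-Vh=o(\|h\|)$. A locally Lipschitz $H$ is called G-semismooth at $x$ if this holds with $\mathcal T=\partial H$, Clarke's generalized Jacobian (equivalently with the Bouligand subdifferential $\partial_BH$). *)

theory Defs
  imports "HOL-Analysis.Analysis"
begin

section \<open>Smoothness\<close>

definition C1_map :: "('a::real_normed_vector \<Rightarrow> 'b::real_normed_vector) \<Rightarrow> bool" where
  "C1_map f \<longleftrightarrow> (\<exists>f' :: 'a \<Rightarrow> 'a \<Rightarrow>\<^sub>L 'b.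
     (\<forall>x. (f has_derivative blinfun_apply (f' x)) (at x)) \<and> continuous_on UNIV f')"

definition C2_map :: "('a::real_normed_vector \<Rightarrow> 'b::real_normed_vector) \<Rightarrow> bool" where
  "C2_map f \<longleftrightarrow> (\<exists>f' :: 'a \<Rightarrow> 'a \<Rightarrow>\<^sub>L 'b.
     (\<forall>x. (f has_derivative blinfun_apply (f' x)) (at x)) \<and> C1_map f')"

abbreviation jac :: "('a::real_normed_vector \<Rightarrow> 'b::real_normed_vector) \<Rightarrow> 'a \<Rightarrow> 'a \<Rightarrow> 'b" where
  "jac G x \<equiv> frechet_derivative G (at x)"

abbreviation nabla :: "('a::real_inner \<Rightarrow> 'b::real_inner) \<Rightarrow> 'a \<Rightarrow> 'b \<Rightarrow> 'a" where
  "nabla G x \<equiv> adjoint (jac G x)"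

section \<open>Normal cones, nondegeneracy and the generalized equation\<close>

text \<open>As usual in convex analysis, the normal cone is empty at points outside the set; the
  constraint \<^prop>\<open>d \<in> D\<close> is thereby built into inclusions that involve the normal cone.\<close>

definition normal_cone :: "'b::real_inner set \<Rightarrow> 'b \<Rightarrow> 'b set" where
  "normal_cone D d = {l. d \<in> D \<and> (\<forall>y\<in>D. l \<bullet> (y - d) \<le> 0)}"

definition nondegenerate ::
    "('a::real_inner \<Rightarrow> 'b::real_inner) \<Rightarrow> 'b set \<Rightarrow> real \<Rightarrow> 'a \<Rightarrow> 'b \<Rightarrow> bool" where
  "nondegenerate G D \<gamma> x d \<longleftrightarrow>
     \<gamma> > 0 \<and> (\<forall>l \<in> span (normal_cone D d). norm (nabla G x l) \<ge> \<gamma> * norm l)"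

definition lagr :: "('a::real_inner \<Rightarrow> 'a) \<Rightarrow> ('a \<Rightarrow> 'b::real_inner) \<Rightarrow> 'b \<Rightarrow> 'a \<Rightarrow> 'a" where
  "lagr F G l x = F x + nabla G x l"

definition solves_GE :: "('a::real_inner \<Rightarrow> 'a) \<Rightarrow> ('a \<Rightarrow> 'b::real_inner) \<Rightarrow> 'b set \<Rightarrow> 'a \<Rightarrow> bool" where
  "solves_GE F G D x \<longleftrightarrow> 0 \<in> (\<lambda>l. F x + nabla G x l) ` normal_cone D (G x)"

text \<open>Well defined if \<^term>\<open>x\<close> solves the generalized equation and \<^term>\<open>(x, G x)\<close> is
  nondegenerate, see \<open>base_multiplier_unique\<close> below.\<close>

definition base_multiplier ::
    "('a::real_inner \<Rightarrow> 'a) \<Rightarrow> ('a \<Rightarrow> 'b::real_inner) \<Rightarrow> 'b set \<Rightarrow> 'a \<Rightarrow> 'b" where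
  "base_multiplier F G D x = (THE l. l \<in> normal_cone D (G x) \<and> lagr F G l x = 0)"

section \<open>The subproblem, its solution and its multiplier\<close>

definition qp_solution ::
    "('a::real_inner \<Rightarrow> 'a) \<Rightarrow> ('a \<Rightarrow> 'b::real_inner) \<Rightarrow> 'b set \<Rightarrow> 'a \<Rightarrow> 'a \<Rightarrow> bool" where
  "qp_solution F G D x u \<longleftrightarrow>
     is_arg_min (\<lambda>u. 1 / 2 * (norm u)\<^sup>2 + F x \<bullet> u) (\<lambda>u. G x + jac G x u \<in> D) u"

definition qp_multiplier ::
    "('a::real_inner \<Rightarrow> 'a) \<Rightarrow> ('a \<Rightarrow> 'b::real_inner) \<Rightarrow> 'b set \<Rightarrow> 'a \<Rightarrow> 'a \<Rightarrow> 'b \<Rightarrow> bool" where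
  "qp_multiplier F G D x u l \<longleftrightarrow>
     l \<in> normal_cone D (G x + jac G x u) \<and> u + F x + nabla G x l = 0"

definition S_set ::
    "('a::real_inner \<Rightarrow> 'a) \<Rightarrow> ('a \<Rightarrow> 'b::real_inner) \<Rightarrow> 'b set \<Rightarrow> 'a \<Rightarrow> 'a set" where
  "S_set F G D x = {u. 0 \<in> (\<lambda>l. u + F x + nabla G x l) ` normal_cone D (G x + jac G x u)}"

definition Lambda_set ::
    "('a::real_inner \<Rightarrow> 'a) \<Rightarrow> ('a \<Rightarrow> 'b::real_inner) \<Rightarrow> 'b set \<Rightarrow> 'a \<Rightarrow> 'b set" where
  "Lambda_set F G D x = {l. \<exists>u. qp_solution F G D x u \<and> qp_multiplier F G D x u l}"

text \<open>Single-valued versions; meaningful only where the sets above are singletons.\<close>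

definition S_map ::
    "('a::real_inner \<Rightarrow> 'a) \<Rightarrow> ('a \<Rightarrow> 'b::real_inner) \<Rightarrow> 'b set \<Rightarrow> 'a \<Rightarrow> 'a" where
  "S_map F G D x = the_elem (S_set F G D x)"

definition Lambda_map ::
    "('a::real_inner \<Rightarrow> 'a) \<Rightarrow> ('a \<Rightarrow> 'b::real_inner) \<Rightarrow> 'b set \<Rightarrow> 'a \<Rightarrow> 'b" where
  "Lambda_map F G D x = the_elem (Lambda_set F G D x)"

text \<open>The radii of balls around the solution \<^term>\<open>xb\<close> (where \<^term>\<open>(xb, G xb)\<close> is nondegenerate
  with modulus \<^term>\<open>\<gamma>\<close>) on which the subproblem behaves well. The third estimate below is
  in the Euclidean norm of the product space of all pairs \<open>((x, d), (x\<^sup>*, d\<^sup>*))\<close>.\<close>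

definition good_radius ::
    "('a::real_inner \<Rightarrow> 'a) \<Rightarrow> ('a \<Rightarrow> 'b::real_inner) \<Rightarrow> 'b set \<Rightarrow> 'a \<Rightarrow> real \<Rightarrow> real \<Rightarrow> bool" where
  "good_radius F G D xb \<gamma> \<omega> \<longleftrightarrow> \<omega> > 0 \<and>
     (\<exists>\<beta> > 0. \<exists>\<beta>u > 0. \<exists>\<beta>l > 0. \<forall>x \<in> cball xb \<omega>. \<exists>u l.
        (\<forall>v. qp_solution F G D x v \<longleftrightarrow> v = u) \<and>
        qp_multiplier F G D x u l \<and>
        (let d = G x + jac G x u in
           norm u \<le> \<beta>u * norm (x - xb) \<and>
           norm (((x, d), (lagr F G l x, G x - d)) - ((xb, G xb), (0, 0))) \<le> \<beta> * norm (x - xb) \<and>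
           norm (l - base_multiplier F G D xb) \<le> \<beta>l * norm (x - xb) \<and>
           nondegenerate G D (\<gamma> / 2) x d \<and>
           normal_cone D d \<subseteq> normal_cone D (G xb)))"

section \<open>Generalized Jacobians and G-semismoothness\<close>

definition bouligand_subdiff ::
    "('a::real_normed_vector \<Rightarrow> 'b::real_normed_vector) \<Rightarrow> 'a \<Rightarrow> ('a \<Rightarrow>\<^sub>L 'b) set" where
  "bouligand_subdiff H x = {V. \<exists>(y :: nat \<Rightarrow> 'a) W. y \<longlonglongrightarrow> x \<and>
     (\<forall>k. (H has_derivative blinfun_apply (W k)) (at (y k))) \<and> W \<longlonglongrightarrow> V}"

definition clarke_jacobian ::
    "('a::real_normed_vector \<Rightarrow> 'b::real_normed_vector) \<Rightarrow> 'a \<Rightarrow> ('a \<Rightarrow>\<^sub>L 'b) set" where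
  "clarke_jacobian H x = convex hull (bouligand_subdiff H x)"

definition G_semismooth_wrt ::
    "'a::real_normed_vector set \<Rightarrow> ('a \<Rightarrow> ('a \<Rightarrow>\<^sub>L 'b) set) \<Rightarrow> ('a \<Rightarrow> 'b::real_normed_vector) \<Rightarrow> 'a \<Rightarrow> bool" where
  "G_semismooth_wrt \<Omega> T H x \<longleftrightarrow> open \<Omega> \<and> x \<in> \<Omega> \<and> continuous_on \<Omega> H \<and>
     (\<forall>e > 0. \<forall>\<^sub>F h in nhds 0. x + h \<in> \<Omega> \<longrightarrow>
        (\<forall>V \<in> T (x + h). norm (H (x + h) - H x - blinfun_apply V h) \<le> e * norm h))"

definition locally_lipschitz_on :: "'a::metric_space set \<Rightarrow> ('a \<Rightarrow> 'b::metric_space) \<Rightarrow> bool" where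
  "locally_lipschitz_on \<Omega> H \<longleftrightarrow> (\<forall>x\<in>\<Omega>. \<exists>r > 0. \<exists>L. L-lipschitz_on (\<Omega> \<inter> ball x r) H)"

definition G_semismooth_at ::
    "'a::real_normed_vector set \<Rightarrow> ('a \<Rightarrow> 'b::real_normed_vector) \<Rightarrow> 'a \<Rightarrow> bool" where
  "G_semismooth_at \<Omega> H x \<longleftrightarrow>
     locally_lipschitz_on \<Omega> H \<and> G_semismooth_wrt \<Omega> (clarke_jacobian H) H x"

section \<open>Well-definedness of the base multiplier\<close>

lemma base_multiplier_unique:
  fixes F :: "'a::euclidean_space \<Rightarrow> 'a" and G :: "'a \<Rightarrow> 'b::euclidean_space"
  assumes "G differentiable (at x)" "solves_GE F G D x" "nondegenerate G D \<gamma> x (G x)"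
  shows "\<exists>!l. l \<in> normal_cone D (G x) \<and> lagr F G l x = 0"
proof -
  have lin: "linear (nabla G x)"
    using assms(1) by (intro adjoint_linear linear_frechet_derivative)
  have "l = m" if "l \<in> normal_cone D (G x)" "m \<in> normal_cone D (G x)"
      "lagr F G l x = 0" "lagr F G m x = 0" for l m
  proof -
    have "l - m \<in> span (normal_cone D (G x))"
      using that by (intro span_diff span_base)
    moreover have "nabla G x (l - m) = 0"
      using that(3,4) unfolding lagr_def linear_diff[OF lin]
      by (metis add_left_cancel cancel_comm_monoid_add_class.diff_cancel)
    ultimately show ?thesis
      using assms(3) by (force simp: nondegenerate_def mult_le_0_iff)
  qed
  then show ?thesis
    using assms(2) unfolding solves_GE_def lagr_def by (auto simp: image_iff)
qed

end

theory Submission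
  imports Defs
begin

text \<open>Subtracting the KKT systems at two points \<open>x\<close> and \<open>y\<close> and using monotonicity of the normal
  cone mapping bounds the differences of solutions and multipliers by \<open>norm (y - x)\<close>, provided the
  difference of the multipliers lies in the span of the normal cone at \<open>x\<close>, where nondegeneracy
  applies. As a polyhedron has only finitely many normal cones, this is so for all \<open>y\<close> close to \<open>x\<close>.
  The resulting calmness is uniform in \<open>x\<close> and hence yields Lipschitz continuity on the ball.

  For semismoothness at \<open>x\<close>, let \<open>S\<close> be differentiable at \<open>y\<close> close to \<open>x\<close> and \<open>z = y + t (y - x)\<close>
  with small \<open>t > 0\<close>. The points \<open>x\<close>, \<open>y\<close>, \<open>z\<close> share a piece of the graph of the normal cone mapping,
  on which the differences of multipliers are orthogonal to those of feasible points. So the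
  estimate above also applies to \<open>(S y - S x) - (S z - S y) / t\<close>, with a right-hand side that is
  \<open>o(norm (y - x))\<close> because the data are strictly differentiable at \<open>x\<close>.\<close>

section \<open>Adjoints of bounded linear functions\<close>

abbreviation adj :: "('a::euclidean_space \<Rightarrow>\<^sub>L 'b::euclidean_space) \<Rightarrow> 'b \<Rightarrow> 'a" where
  "adj A \<equiv> adjoint (blinfun_apply A)"

lemma adj_inner: "adj A l \<bullet> v = l \<bullet> blinfun_apply A v"
  by (metis adjoint_works blinfun.bounded_linear_right bounded_linear.linear inner_commute)

lemma linear_adj: "linear (adj A)"
  by (intro adjoint_linear bounded_linear.linear blinfun.bounded_linear_right)

lemmas adj_right_simps =
  linear_diff[OF linear_adj] linear_add[OF linear_adj] linear_scale[OF linear_adj]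

lemma adj_diff_left: "adj (A - B) l = adj A l - adj B l"
  by (rule vector_eq_rdot[THEN iffD1])
    (simp add: adj_inner inner_diff_left inner_diff_right blinfun.diff_left)

lemma adj_scaleR_left: "adj (s *\<^sub>R A) l = s *\<^sub>R adj A l"
  by (rule vector_eq_rdot[THEN iffD1]) (simp add: adj_inner blinfun.scaleR_left)

lemma norm_adj_le: "norm (adj A l) \<le> norm A * norm l"
proof -
  have "norm (adj A l) * norm (adj A l) = l \<bullet> blinfun_apply A (adj A l)"
    by (metis adj_inner power2_eq_square power2_norm_eq_inner)
  also have "\<dots> \<le> norm l * norm (blinfun_apply A (adj A l))"
    by (rule norm_cauchy_schwarz)
  also have "\<dots> \<le> norm l * (norm A * norm (adj A l))"
    by (intro mult_left_mono norm_blinfun) auto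
  finally show ?thesis
    by (cases "norm (adj A l) = 0") (auto simp: algebra_simps)
qed

section \<open>Normal cones of polyhedra\<close>

lemma normal_coneD: "l \<in> normal_cone D d \<Longrightarrow> y \<in> D \<Longrightarrow> l \<bullet> (y - d) \<le> 0"
  by (simp add: normal_cone_def)

lemma normal_cone_memD: "l \<in> normal_cone D d \<Longrightarrow> d \<in> D"
  by (simp add: normal_cone_def)

lemma normal_cone_monotone:
  assumes "l \<in> normal_cone D d" "m \<in> normal_cone D e"
  shows "0 \<le> (l - m) \<bullet> (d - e)"
  using normal_coneD[OF assms(1) normal_cone_memD[OF assms(2)]]
    normal_coneD[OF assms(2) normal_cone_memD[OF assms(1)]]
  by (simp add: inner_diff_left inner_diff_right)

lemma closed_normal_cone: "closed (normal_cone D d)"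
proof (cases "d \<in> D")
  case True
  then have "normal_cone D d = (\<Inter>y\<in>D. {l. l \<bullet> (y - d) \<le> 0})"
    by (auto simp: normal_cone_def)
  then show ?thesis
    by (auto intro!: closed_INT closed_Collect_le continuous_intros)
qed (simp add: normal_cone_def)

text \<open>For fixed \<open>l\<close>, membership of \<open>l\<close> in the cone at
  \<open>d\<close> amounts to \<open>d \<in> D\<close> and weak inequalities that are affine in
  \<open>d\<close>. This closedness is what makes normal cones shrink in passing from a point to
  nearby points.\<close>

lemma closed_normal_cone_superset:
  assumes "closed D" shows "closed {d. N \<subseteq> normal_cone D d}"
proof -
  have "{d. l \<in> normal_cone D d} = D \<inter> (\<Inter>y\<in>D. {d. l \<bullet> (y - d) \<le> 0})" for l
    by (auto simp: normal_cone_def)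
  then have "closed {d. l \<in> normal_cone D d}" for l
    using assms by (auto intro!: closed_INT closed_Int closed_Collect_le continuous_intros)
  moreover have "{d. N \<subseteq> normal_cone D d} = (\<Inter>l\<in>N. {d. l \<in> normal_cone D d})"
    by auto
  ultimately show ?thesis
    by (auto intro!: closed_INT)
qed

text \<open>A short step from \<open>d\<close> in a direction \<open>y - e\<close> stays in
  \<open>D\<close>: constraints active at \<open>d\<close> are active at \<open>e\<close> and so do
  not increase along it, while the others have slack at \<open>d\<close>. Testing \<open>l\<close>
  against the resulting point gives the claim.\<close>

lemma normal_cone_mono_active:
  fixes a :: "'i \<Rightarrow> 'b::real_inner" and b :: "'i \<Rightarrow> real"
  assumes "finite I" and D: "D = {x. \<forall>i\<in>I. a i \<bullet> x \<le> b i}"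
    and de: "d \<in> D" "e \<in> D"
    and act: "\<And>i. i \<in> I \<Longrightarrow> a i \<bullet> d = b i \<Longrightarrow> a i \<bullet> e = b i"
  shows "normal_cone D d \<subseteq> normal_cone D e"
proof
  fix l assume l: "l \<in> normal_cone D d"
  have "l \<bullet> (y - e) \<le> 0" if y: "y \<in> D" for y
  proof -
    have "\<forall>\<^sub>F s in at_right 0. a i \<bullet> (d + s *\<^sub>R (y - e)) \<le> b i" if i: "i \<in> I" for i
    proof (cases "a i \<bullet> d = b i")
      case True
      then have "a i \<bullet> (y - e) \<le> 0"
        using act[OF i] y i by (simp add: D inner_diff_right)
      then have "a i \<bullet> (d + s *\<^sub>R (y - e)) \<le> b i" if "s > 0" for s
        using True that by (simp add: inner_add_right mult_le_0_iff)
      then show ?thesis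
        by (auto intro: eventually_at_rightI[of 0 1])
    next
      case False
      have "((\<lambda>s. a i \<bullet> (d + s *\<^sub>R (y - e))) \<longlongrightarrow> a i \<bullet> (d + 0 *\<^sub>R (y - e))) (at_right 0)"
        by (intro tendsto_intros)
      moreover have "a i \<bullet> (d + 0 *\<^sub>R (y - e)) < b i"
        using False de(1) i by (auto simp: D less_le)
      ultimately have "\<forall>\<^sub>F s in at_right 0. a i \<bullet> (d + s *\<^sub>R (y - e)) < b i"
        by (rule order_tendstoD)
      then show ?thesis by eventually_elim simp
    qed
    then have "\<forall>\<^sub>F s in at_right 0. \<forall>i\<in>I. a i \<bullet> (d + s *\<^sub>R (y - e)) \<le> b i"
      using \<open>finite I\<close> by (simp add: eventually_ball_finite)
    moreover have "\<forall>\<^sub>F s::real in at_right 0. s > 0"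
      by (rule eventually_at_right_less)
    ultimately have "\<forall>\<^sub>F s in at_right 0. s > 0 \<and> d + s *\<^sub>R (y - e) \<in> D"
      by eventually_elim (simp add: D)
    then obtain s where "s > 0" "d + s *\<^sub>R (y - e) \<in> D"
      using eventually_happens' trivial_limit_at_right_real by blast
    then show ?thesis
      using normal_coneD[OF l, of "d + s *\<^sub>R (y - e)"] by (simp add: mult_le_0_iff)
  qed
  with de show "l \<in> normal_cone D e"
    by (simp add: normal_cone_def)
qed

text \<open>The normal cone depends only on the set of active constraints, so one representative
  point per active set suffices; the empty set accounts for points outside \<open>D\<close>.\<close>

lemma finite_range_normal_cone:
  fixes D :: "'b::euclidean_space set"
  assumes "polyhedron D" shows "finite (range (normal_cone D))"
proof -
  obtain I where I: "finite I" "D = \<Inter>I"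
      "\<forall>h\<in>I. \<exists>a b. a \<noteq> (0::'b) \<and> h = {x. a \<bullet> x \<le> b}"
    using assms unfolding polyhedron_def by blast
  then obtain a b where ab: "\<And>h. h \<in> I \<Longrightarrow> h = {x. a h \<bullet> x \<le> b h}"
    by metis
  then have D: "D = {x. \<forall>h\<in>I. a h \<bullet> x \<le> b h}"
    using I(2) by blast
  define act where "act d = {h\<in>I. a h \<bullet> d = b h}" for d
  have mono: "normal_cone D d \<subseteq> normal_cone D e"
    if "d \<in> D" "e \<in> D" "act d \<subseteq> act e" for d e
    using that by (intro normal_cone_mono_active[OF I(1) D]) (auto simp: act_def)
  \<comment> \<open>If no point has active set \<open>J\<close>, the value is arbitrary; this merely
    adds one more cone to a finite family.\<close>
  define sel where "sel J = (SOME d. d \<in> D \<and> act d = J)" for J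
  have "normal_cone D d \<in> insert {} ((\<lambda>J. normal_cone D (sel J)) ` Pow I)" for d
  proof (cases "d \<in> D")
    case True
    then have "sel (act d) \<in> D \<and> act (sel (act d)) = act d"
      unfolding sel_def by (rule_tac someI[of _ d]) simp
    then have "normal_cone D d = normal_cone D (sel (act d))"
      using True by (intro equalityI mono) auto
    then show ?thesis
      by (auto simp: act_def)
  qed (simp add: normal_cone_def)
  then have "range (normal_cone D) \<subseteq> insert {} ((\<lambda>J. normal_cone D (sel J)) ` Pow I)"
    by blast
  then show ?thesis
    by (rule finite_subset) (simp add: I(1))
qed

text \<open>Each closed set that misses \<open>p\<close> is eventually avoided by \<open>f\<close>;
  finiteness lets these conditions hold simultaneously.\<close>

lemma eventually_in_closed_family:
  assumes "finite \<C>" "\<And>C. C \<in> \<C> \<Longrightarrow> closed C" "(f \<longlongrightarrow> p) X"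
  shows "\<forall>\<^sub>F x in X. \<forall>C\<in>\<C>. f x \<in> C \<longrightarrow> p \<in> C"
  unfolding eventually_ball_finite_distrib[OF assms(1)]
proof
  fix C assume "C \<in> \<C>"
  show "\<forall>\<^sub>F x in X. f x \<in> C \<longrightarrow> p \<in> C"
  proof (cases "p \<in> C")
    case False
    then have "\<forall>\<^sub>F x in X. f x \<in> - C"
      using assms(2)[OF \<open>C \<in> \<C>\<close>] by (intro topological_tendstoD[OF assms(3)]) auto
    then show ?thesis by eventually_elim simp
  qed simp
qed

section \<open>Lipschitz continuity from calmness\<close>

text \<open>Bisection: the estimate is additive over adjacent intervals, and on a short interval
  around \<open>x\<close> it follows from calmness at \<open>x\<close> by passing through
  \<open>f x\<close>.\<close>

lemma norm_diff_le_of_calm_real: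
  fixes f :: "real \<Rightarrow> 'b::real_normed_vector"
  assumes "a \<le> b"
    and calm: "\<And>x. a \<le> x \<Longrightarrow> x \<le> b \<Longrightarrow>
      \<exists>d>0. \<forall>y. a \<le> y \<and> y \<le> b \<and> \<bar>y - x\<bar> < d \<longrightarrow> norm (f y - f x) \<le> L * \<bar>y - x\<bar>"
  shows "norm (f b - f a) \<le> L * (b - a)"
proof -
  have "a \<le> a \<and> b \<le> b \<longrightarrow> norm (f b - f a) \<le> L * (b - a)"
  \<comment> \<open>The guard is there because the local condition of \<open>Bolzano\<close> also
    ranges over intervals that leave \<open>[a, b]\<close>.\<close>
  proof (rule Bolzano[where P = "\<lambda>s t. a \<le> s \<and> t \<le> b \<longrightarrow> norm (f t - f s) \<le> L * (t - s)"])
    show "a \<le> p \<and> r \<le> b \<longrightarrow> norm (f r - f p) \<le> L * (r - p)"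
      if "a \<le> p \<and> q \<le> b \<longrightarrow> norm (f q - f p) \<le> L * (q - p)"
        "a \<le> q \<and> r \<le> b \<longrightarrow> norm (f r - f q) \<le> L * (r - q)" "p \<le> q" "q \<le> r" for p q r
      using that norm_triangle_ineq[of "f r - f q" "f q - f p"] by (auto simp: algebra_simps)
    fix x assume x: "a \<le> x" "x \<le> b"
    then obtain d where "d > 0"
      and d: "\<And>y. a \<le> y \<Longrightarrow> y \<le> b \<Longrightarrow> \<bar>y - x\<bar> < d \<Longrightarrow> norm (f y - f x) \<le> L * \<bar>y - x\<bar>"
      using calm by metis
    have "norm (f t - f s) \<le> L * (t - s)"
      if "s \<le> x" "x \<le> t" "t - s < d" "a \<le> s" "t \<le> b" for s t
      using d[of t] d[of s] that x norm_triangle_ineq[of "f t - f x" "f x - f s"]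
      by (auto simp: algebra_simps norm_minus_commute)
    then show "\<exists>d>0. \<forall>s t. s \<le> x \<and> x \<le> t \<and> t - s < d \<longrightarrow>
        a \<le> s \<and> t \<le> b \<longrightarrow> norm (f t - f s) \<le> L * (t - s)"
      using \<open>d > 0\<close> by blast
  qed (rule assms(1))
  then show ?thesis by simp
qed

text \<open>Restriction to the segment between two points reduces this to the real case. The
  neighbourhoods may depend on the point, but \<open>L\<close> may not.\<close>

lemma lipschitz_on_of_calm:
  fixes f :: "'a::real_normed_vector \<Rightarrow> 'b::real_normed_vector"
  assumes "convex K" "L \<ge> 0"
    and calm: "\<And>x. x \<in> K \<Longrightarrow>
      \<forall>\<^sub>F y in at x within K. norm (f y - f x) \<le> L * norm (y - x)"
  shows "L-lipschitz_on K f"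
proof (rule lipschitz_onI)
  fix x y assume xy: "x \<in> K" "y \<in> K"
  define p where "p t = x + t *\<^sub>R (y - x)" for t
  have pK: "p t \<in> K" if "0 \<le> t" "t \<le> 1" for t
    using convexD_alt[OF assms(1) xy that] by (simp add: p_def algebra_simps)
  have pd: "p s - p t = (s - t) *\<^sub>R (y - x)" for s t
    by (simp add: p_def algebra_simps)
  have "norm (f (p 1) - f (p 0)) \<le> (L * norm (y - x)) * (1 - 0)"
  proof (rule norm_diff_le_of_calm_real[where f = "\<lambda>t. f (p t)"])
    fix t :: real assume t: "0 \<le> t" "t \<le> 1"
    obtain d where "d > 0"
      and d: "\<And>z. z \<in> K \<Longrightarrow> z \<noteq> p t \<Longrightarrow> dist z (p t) < d \<Longrightarrow>
          norm (f z - f (p t)) \<le> L * norm (z - p t)"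
      using calm[OF pK[OF t]] unfolding eventually_at by blast
    \<comment> \<open>Adding 1 to the speed \<open>norm (y - x)\<close> of the path \<open>p\<close>
      avoids a division by zero when \<open>x = y\<close>.\<close>
    define r where "r = d / (1 + norm (y - x))"
    have "norm (f (p s) - f (p t)) \<le> L * norm (y - x) * \<bar>s - t\<bar>"
      if "0 \<le> s" "s \<le> 1" "\<bar>s - t\<bar> < r" for s
    proof -
      have "dist (p s) (p t) \<le> \<bar>s - t\<bar> * (1 + norm (y - x))"
        by (simp add: dist_norm pd distrib_left)
      also have "\<dots> < d"
        using that(3) by (simp add: r_def less_divide_eq add_nonneg_pos add_pos_nonneg)
      finally show ?thesis
        using d[OF pK[OF that(1,2)]] by (cases "p s = p t") (auto simp: pd ac_simps assms(2))
    qed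
    moreover have "r > 0"
      using \<open>d > 0\<close> by (simp add: r_def add_pos_nonneg)
    ultimately show "\<exists>d>0. \<forall>s. 0 \<le> s \<and> s \<le> 1 \<and> \<bar>s - t\<bar> < d \<longrightarrow>
        norm (f (p s) - f (p t)) \<le> L * norm (y - x) * \<bar>s - t\<bar>"
      by blast
  qed simp
  then show "dist (f x) (f y) \<le> L * dist x y"
    by (simp add: p_def dist_norm norm_minus_commute)
qed (rule assms(2))

section \<open>Strict differentiability\<close>

text \<open>Both points vary here, unlike in Frechet differentiability: the increments from
  \<open>x\<close> to \<open>y\<close> and from \<open>y\<close> to \<open>z\<close> are to be
  compared through one and the same derivative.\<close>

definition strictly_differentiable_at ::
    "('a::real_normed_vector \<Rightarrow> 'b::real_normed_vector) \<Rightarrow> 'a \<Rightarrow> bool" where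
  "strictly_differentiable_at f x \<longleftrightarrow> (\<exists>f'. bounded_linear f' \<and> (\<forall>e>0. \<exists>r>0.
     \<forall>y\<in>ball x r. \<forall>z\<in>ball x r. norm (f z - f y - f' (z - y)) \<le> e * norm (z - y)))"

text \<open>Both increments, the second one rescaled, approximate the same vector
  \<open>f' (y - x)\<close> with error \<open>e / 2 * norm (y - x)\<close>, so the derivative
  cancels.\<close>

lemma strictly_differentiable_at_extrapolate:
  assumes "strictly_differentiable_at f x" "e > 0"
  obtains r where "r > 0"
    and "\<And>y t. \<lbrakk>y \<in> ball x r; y + t *\<^sub>R (y - x) \<in> ball x r; t > 0\<rbrakk> \<Longrightarrow>
      norm ((f y - f x) - (f (y + t *\<^sub>R (y - x)) - f y) /\<^sub>R t) \<le> e * norm (y - x)"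
proof -
  obtain f' r where f': "bounded_linear f'" and "r > 0"
    and r: "\<And>y z. y \<in> ball x r \<Longrightarrow> z \<in> ball x r \<Longrightarrow>
        norm (f z - f y - f' (z - y)) \<le> e / 2 * norm (z - y)"
    using assms unfolding strictly_differentiable_at_def by (meson half_gt_zero)
  have "norm ((f y - f x) - (f (y + t *\<^sub>R (y - x)) - f y) /\<^sub>R t) \<le> e * norm (y - x)"
    if y: "y \<in> ball x r" and z: "y + t *\<^sub>R (y - x) \<in> ball x r" and t: "t > 0" for y t
  proof -
    let ?z = "y + t *\<^sub>R (y - x)"
    interpret bounded_linear f' by (rule f')
    have "norm (f ?z - f y - t *\<^sub>R f' (y - x)) \<le> e / 2 * (t * norm (y - x))"
      using r[OF y z] t by (simp add: scaleR)
    then have "t * norm ((f ?z - f y) /\<^sub>R t - f' (y - x)) \<le> t * (e / 2 * norm (y - x))"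
      using t norm_scaleR[of t "(f ?z - f y) /\<^sub>R t - f' (y - x)"]
      by (simp add: scaleR_diff_right algebra_simps)
    then have "norm ((f ?z - f y) /\<^sub>R t - f' (y - x)) \<le> e / 2 * norm (y - x)"
      using t by simp
    moreover have "norm (f y - f x - f' (y - x)) \<le> e / 2 * norm (y - x)"
      using r[of x y] y \<open>r > 0\<close> by simp
    ultimately show ?thesis
      using norm_triangle_ineq4[of "f y - f x - f' (y - x)" "(f ?z - f y) /\<^sub>R t - f' (y - x)"]
      by simp
  qed
  then show thesis using \<open>r > 0\<close> that by blast
qed

text \<open>Mean value inequality for \<open>f\<close> minus its linearization, on a ball where
  \<open>f'\<close> stays within \<open>e\<close> of \<open>f' x\<close>.\<close>

lemma C1_map_strictly_differentiable_at:
  assumes "C1_map f" shows "strictly_differentiable_at f x"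
proof -
  obtain f' where f': "\<And>x. (f has_derivative blinfun_apply (f' x)) (at x)"
    and cont: "continuous_on UNIV f'"
    using assms unfolding C1_map_def by blast
  have "\<exists>r>0. \<forall>y\<in>ball x r. \<forall>z\<in>ball x r.
      norm (f z - f y - blinfun_apply (f' x) (z - y)) \<le> e * norm (z - y)" if "e > 0" for e
  proof -
    obtain r where "r > 0" and r: "\<And>y. dist y x < r \<Longrightarrow> dist (f' y) (f' x) < e"
      using cont \<open>e > 0\<close> unfolding continuous_on_iff by (metis UNIV_I)
    have "norm (f z - f y - blinfun_apply (f' x) (z - y)) \<le> e * norm (z - y)"
      if yz: "y \<in> ball x r" "z \<in> ball x r" for y z
    proof -
      have "norm ((f z - blinfun_apply (f' x) z) - (f y - blinfun_apply (f' x) y)) \<le> e * norm (z - y)"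
      proof (rule differentiable_bound[OF convex_ball _ _ yz(2) yz(1)])
        fix v assume v: "v \<in> ball x r"
        show "((\<lambda>v. f v - blinfun_apply (f' x) v) has_derivative blinfun_apply (f' v - f' x))
            (at v within ball x r)"
          using has_derivative_at_withinI[OF f']
          by (auto intro!: derivative_eq_intros simp: blinfun.diff_left)
        show "onorm (blinfun_apply (f' v - f' x)) \<le> e"
          using r[of v] v by (simp add: norm_blinfun.rep_eq[symmetric] dist_norm dist_commute norm_minus_commute)
      qed
      then show ?thesis by (simp add: blinfun.diff_right algebra_simps)
    qed
    with \<open>r > 0\<close> show ?thesis by blast
  qed
  then show ?thesis
    unfolding strictly_differentiable_at_def using blinfun.bounded_linear_right by blast
qed

lemma C1_map_lipschitz_on:
  fixes f :: "'a::euclidean_space \<Rightarrow> 'b::real_normed_vector"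
  assumes "C1_map f" "compact K" "convex K"
  obtains L where "L-lipschitz_on K f"
proof -
  obtain f' where f': "\<And>x. (f has_derivative blinfun_apply (f' x)) (at x)"
    and cont: "continuous_on UNIV f'"
    using assms unfolding C1_map_def by blast
  have "compact (f' ` K)"
    using cont assms(2) by (intro compact_continuous_image) (auto intro: continuous_on_subset)
  then obtain B where B: "B > 0" "\<And>x. x \<in> K \<Longrightarrow> norm (f' x) \<le> B"
    using compact_imp_bounded bounded_pos by (metis imageI)
  have "B-lipschitz_on K f"
    using B by (intro bounded_derivative_imp_lipschitz[where f' = "\<lambda>x. blinfun_apply (f' x)"] assms(3))
      (auto intro: has_derivative_at_withinI f' simp: norm_blinfun.rep_eq[symmetric])
  then show thesis by (rule that)
qed

section \<open>Solution and multiplier mappings\<close>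

text \<open>Testing the equation with \<open>w\<close> turns the adjoint term into
  \<open>q \<bullet> blinfun_apply A w\<close>, which monotonicity bounds from below. Nondegeneracy
  does not enter, so the estimate is available before the cones at two points are related.\<close>

lemma perturbed_kkt_energy:
  fixes A :: "'a::euclidean_space \<Rightarrow>\<^sub>L 'b::euclidean_space"
  assumes "w + adj A q = r1" "0 \<le> q \<bullet> (blinfun_apply A w + r2)"
  shows "(norm w)\<^sup>2 \<le> norm w * norm r1 + norm q * norm r2"
proof -
  have "(norm w)\<^sup>2 = r1 \<bullet> w - q \<bullet> blinfun_apply A w"
    by (simp add: assms(1)[symmetric] inner_add_left adj_inner power2_norm_eq_inner)
  also have "\<dots> \<le> r1 \<bullet> w + q \<bullet> r2"
    using assms(2) by (simp add: inner_add_right)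
  also have "\<dots> \<le> norm w * norm r1 + norm q * norm r2"
    by (metis add_mono mult.commute norm_cauchy_schwarz)
  finally show ?thesis .
qed

text \<open>Nondegeneracy bounds \<open>q\<close> through the equation by \<open>w\<close> and
  \<open>r1\<close>. Inserted into the energy estimate, this leaves a quadratic inequality for
  \<open>norm w\<close> alone.\<close>

lemma perturbed_kkt_bounds:
  fixes A :: "'a::euclidean_space \<Rightarrow>\<^sub>L 'b::euclidean_space"
  assumes eq: "w + adj A q = r1" and mono: "0 \<le> q \<bullet> (blinfun_apply A w + r2)"
    and c: "c > 0" "c * norm q \<le> norm (adj A q)"
  shows "norm w \<le> 2 * (norm r1 + norm r2 / c)" "norm q \<le> 3 * (norm r1 + norm r2 / c) / c"
proof -
  define R where "R = norm r1 + norm r2 / c"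
  have R: "norm r1 \<le> R" "R \<ge> 0"
    using c by (auto simp: R_def)
  have "norm (adj A q) \<le> norm w + norm r1"
    using norm_triangle_ineq4[of r1 w] unfolding eq[symmetric] by simp
  then have q: "norm q \<le> (norm w + norm r1) / c"
    using c by (simp add: field_simps)
  have "(norm w)\<^sup>2 \<le> norm w * norm r1 + norm q * norm r2"
    by (rule perturbed_kkt_energy[OF eq mono])
  also have "\<dots> \<le> norm w * norm r1 + (norm w + norm r1) / c * norm r2"
    using q by (intro add_left_mono mult_right_mono) auto
  also have "\<dots> = norm w * R + norm r1 * (norm r2 / c)"
    by (simp add: R_def add_divide_distrib algebra_simps)
  also have "\<dots> \<le> norm w * R + R * R"
    using c R by (intro add_left_mono mult_mono) (auto simp: R_def)
  \<comment> \<open>The inequality \<open>(norm w)\<^sup>2 \<le> norm w * R + R * R\<close> in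
    factored form, from which the sign of the first factor can be read off.\<close>
  finally have "(norm w - 2 * R) * (norm w + R) \<le> - (R * R)"
    by (simp add: algebra_simps power2_eq_square)
  also have "\<dots> \<le> 0" by simp
  finally have "norm w \<le> 2 * R"
    using R by (auto simp: mult_le_0_iff)
  then show "norm w \<le> 2 * (norm r1 + norm r2 / c)"
    by (simp add: R_def)
  have "(norm w + norm r1) / c \<le> 3 * R / c"
    using \<open>norm w \<le> 2 * R\<close> R c by (intro divide_right_mono) auto
  with q show "norm q \<le> 3 * (norm r1 + norm r2 / c) / c"
    by (simp add: R_def)
qed

text \<open>In the application \<open>A\<close> is the Jacobian of \<open>G\<close>,
  \<open>K\<close> the ball, and \<open>u\<close>, \<open>l\<close> are the solution and multiplier
  mappings. All constants are uniform over \<open>K\<close>, so the calmness constants derived from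
  them do not depend on the point.\<close>

locale kkt_family =
  fixes F :: "'a::euclidean_space \<Rightarrow> 'a" and G :: "'a \<Rightarrow> 'b::euclidean_space"
    and A :: "'a \<Rightarrow> 'a \<Rightarrow>\<^sub>L 'b" and D :: "'b set" and K :: "'a set"
    and u :: "'a \<Rightarrow> 'a" and l :: "'a \<Rightarrow> 'b" and c LF LG LA Bu Bl :: real
  assumes polyhedron: "polyhedron D"
    and stationary: "x \<in> K \<Longrightarrow> u x + F x + adj (A x) (l x) = 0"
    and multiplier: "x \<in> K \<Longrightarrow> l x \<in> normal_cone D (G x + blinfun_apply (A x) (u x))"
    and c_pos: "c > 0"
    and nondeg: "x \<in> K \<Longrightarrow> m \<in> span (normal_cone D (G x + blinfun_apply (A x) (u x)))
      \<Longrightarrow> c * norm m \<le> norm (adj (A x) m)"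
    and convex: "convex K"
    and u_bound: "x \<in> K \<Longrightarrow> norm (u x) \<le> Bu"
    and l_bound: "x \<in> K \<Longrightarrow> norm (l x) \<le> Bl"
    and F_lipschitz: "LF-lipschitz_on K F"
    and G_lipschitz: "LG-lipschitz_on K G"
    and A_lipschitz: "LA-lipschitz_on K A"
begin

definition d :: "'a \<Rightarrow> 'b" where "d x = G x + blinfun_apply (A x) (u x)"

text \<open>A joint Lipschitz constant for the two residuals that arise when the system at
  \<open>y\<close> is read as a perturbation of the one at \<open>x\<close>. Absolute values keep it
  nonnegative even for empty \<open>K\<close>.\<close>

definition C :: real where "C = LF + LG + LA * (\<bar>Bu\<bar> + \<bar>Bl\<bar>)"

section \<open>Differences of the KKT systems at two points\<close>

lemma LF_nonneg: "LF \<ge> 0" and LG_nonneg: "LG \<ge> 0" and LA_nonneg: "LA \<ge> 0"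
  using F_lipschitz G_lipschitz A_lipschitz lipschitz_on_nonneg by blast+

lemma C_nonneg: "C \<ge> 0"
  using LF_nonneg LG_nonneg LA_nonneg by (simp add: C_def)

lemma multiplier_d: "x \<in> K \<Longrightarrow> l x \<in> normal_cone D (d x)"
  using multiplier by (simp add: d_def)

lemma stationary_diff:
  assumes "x \<in> K" "y \<in> K"
  shows "(u y - u x) + (F y - F x) + adj (A y - A x) (l y) + adj (A x) (l y - l x) = 0"
proof -
  have "(u y - u x) + (F y - F x) + adj (A y - A x) (l y) + adj (A x) (l y - l x) =
      (u y + F y + adj (A y) (l y)) - (u x + F x + adj (A x) (l x))"
    by (simp add: adj_diff_left adj_right_simps)
  then show ?thesis
    by (simp only: stationary[OF assms(1)] stationary[OF assms(2)]) simp
qed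

lemma d_diff:
  "d y - d x = blinfun_apply (A x) (u y - u x) + ((G y - G x) + blinfun_apply (A y - A x) (u y))"
  by (simp add: d_def blinfun.diff_left blinfun.diff_right)

lemma perturbation_bounds:
  assumes "x \<in> K" "y \<in> K"
  shows "norm (- ((F y - F x) + adj (A y - A x) (l y))) \<le> C * norm (y - x)" (is ?F)
    and "norm ((G y - G x) + blinfun_apply (A y - A x) (u y)) \<le> C * norm (y - x)" (is ?G)
proof -
  have lip: "norm (F y - F x) \<le> LF * norm (y - x)" "norm (G y - G x) \<le> LG * norm (y - x)"
      "norm (A y - A x) \<le> LA * norm (y - x)"
    using lipschitz_onD[OF F_lipschitz assms(2,1)] lipschitz_onD[OF G_lipschitz assms(2,1)]
      lipschitz_onD[OF A_lipschitz assms(2,1)] by (simp_all add: dist_norm)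
  have "norm (adj (A y - A x) (l y)) \<le> norm (A y - A x) * norm (l y)"
    by (rule norm_adj_le)
  also have "\<dots> \<le> (LA * norm (y - x)) * \<bar>Bl\<bar>"
    using lip(3) l_bound[OF assms(2)] LA_nonneg by (intro mult_mono) auto
  finally have 1: "norm (adj (A y - A x) (l y)) \<le> LA * \<bar>Bl\<bar> * norm (y - x)"
    by (simp add: ac_simps)
  have "norm (blinfun_apply (A y - A x) (u y)) \<le> norm (A y - A x) * norm (u y)"
    by (rule norm_blinfun)
  also have "\<dots> \<le> (LA * norm (y - x)) * \<bar>Bu\<bar>"
    using lip(3) u_bound[OF assms(2)] LA_nonneg by (intro mult_mono) auto
  finally have 2: "norm (blinfun_apply (A y - A x) (u y)) \<le> LA * \<bar>Bu\<bar> * norm (y - x)"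
    by (simp add: ac_simps)
  have "norm ((F y - F x) + adj (A y - A x) (l y)) \<le> (LF + LA * \<bar>Bl\<bar>) * norm (y - x)"
    using norm_triangle_ineq[of "F y - F x" "adj (A y - A x) (l y)"] lip(1) 1
    by (simp add: algebra_simps)
  also have "\<dots> \<le> C * norm (y - x)"
    using LG_nonneg LA_nonneg by (intro mult_right_mono) (auto simp: C_def algebra_simps)
  finally show ?F by (simp add: norm_minus_cancel del: minus_add_distrib)
  have "norm ((G y - G x) + blinfun_apply (A y - A x) (u y)) \<le> (LG + LA * \<bar>Bu\<bar>) * norm (y - x)"
    using norm_triangle_ineq[of "G y - G x" "blinfun_apply (A y - A x) (u y)"] lip(2) 2
    by (simp add: algebra_simps)
  also have "\<dots> \<le> C * norm (y - x)"
    using LF_nonneg LA_nonneg by (intro mult_right_mono) (auto simp: C_def algebra_simps)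
  finally show ?G .
qed

lemma diff_monotone:
  assumes "x \<in> K" "y \<in> K"
  shows "0 \<le> (l y - l x) \<bullet> (blinfun_apply (A x) (u y - u x) +
    ((G y - G x) + blinfun_apply (A y - A x) (u y)))"
  using normal_cone_monotone[OF multiplier_d[OF assms(2)] multiplier_d[OF assms(1)]]
  by (simp only: d_diff)

text \<open>At this stage the multipliers are only known to be bounded, which gives a
  Hoelder estimate of order 1/2.\<close>

lemma continuous_u: "continuous_on K u"
proof -
  have bound: "(norm (u y - u x))\<^sup>2 \<le> C * (2 * \<bar>Bu\<bar> + 2 * \<bar>Bl\<bar>) * norm (y - x)"
    if xy: "x \<in> K" "y \<in> K" for x y
  proof -
    have u: "norm (u y - u x) \<le> 2 * \<bar>Bu\<bar>"
      using norm_triangle_ineq4[of "u y" "u x"] u_bound[OF xy(1)] u_bound[OF xy(2)] by simp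
    have l: "norm (l y - l x) \<le> 2 * \<bar>Bl\<bar>"
      using norm_triangle_ineq4[of "l y" "l x"] l_bound[OF xy(1)] l_bound[OF xy(2)] by simp
    have "(norm (u y - u x))\<^sup>2 \<le>
        norm (u y - u x) * norm (- ((F y - F x) + adj (A y - A x) (l y))) +
        norm (l y - l x) * norm ((G y - G x) + blinfun_apply (A y - A x) (u y))"
      using stationary_diff[OF xy] diff_monotone[OF xy]
      by (intro perturbed_kkt_energy[where A = "A x"]) (auto simp: add_eq_0_iff algebra_simps)
    also have "\<dots> \<le> (2 * \<bar>Bu\<bar>) * (C * norm (y - x)) + (2 * \<bar>Bl\<bar>) * (C * norm (y - x))"
      using u l perturbation_bounds[OF xy] by (intro add_mono mult_mono) auto
    finally show ?thesis by (simp add: algebra_simps)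
  qed
  have "(u \<longlongrightarrow> u x) (at x within K)" if "x \<in> K" for x
  proof -
    have "((\<lambda>y. C * (2 * \<bar>Bu\<bar> + 2 * \<bar>Bl\<bar>) * norm (y - x)) \<longlongrightarrow>
        C * (2 * \<bar>Bu\<bar> + 2 * \<bar>Bl\<bar>) * norm (x - x)) (at x within K)"
      by (intro tendsto_intros)
    then have lim: "((\<lambda>y. C * (2 * \<bar>Bu\<bar> + 2 * \<bar>Bl\<bar>) * norm (y - x)) \<longlongrightarrow> 0) (at x within K)"
      by simp
    have "((\<lambda>y. (norm (u y - u x))\<^sup>2) \<longlongrightarrow> 0) (at x within K)"
      using bound[OF that] by (intro tendsto_sandwich[OF _ _ tendsto_const lim])
        (auto simp: eventually_at_filter)
    then have "((\<lambda>y. sqrt ((norm (u y - u x))\<^sup>2)) \<longlongrightarrow> sqrt 0) (at x within K)"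
      by (rule tendsto_real_sqrt)
    then show ?thesis
      by (simp add: tendsto_norm_zero_iff LIM_zero_iff)
  qed
  then show ?thesis by (simp add: continuous_on_def)
qed

section \<open>Calmness and Lipschitz continuity\<close>

lemma continuous_d: "continuous_on K d"
  unfolding d_def
  by (intro continuous_intros continuous_u lipschitz_on_continuous_on[OF G_lipschitz]
      lipschitz_on_continuous_on[OF A_lipschitz])

text \<open>The closed sets \<open>{d. N \<subseteq> normal_cone D d}\<close> form a finite family
  as \<open>N\<close> ranges over the normal cones. By definition \<open>d y\<close> belongs to the
  one with \<open>N = normal_cone D (d y)\<close>, hence so does the limit
  \<open>d x\<close>.\<close>

lemma eventually_normal_cone_subset:
  assumes "x \<in> K"
  shows "\<forall>\<^sub>F y in at x within K. normal_cone D (d y) \<subseteq> normal_cone D (d x)"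
proof -
  have "\<forall>\<^sub>F y in at x within K.
      \<forall>S\<in>(\<lambda>N. {d. N \<subseteq> normal_cone D d}) ` range (normal_cone D). d y \<in> S \<longrightarrow> d x \<in> S"
    using continuous_d assms polyhedron
    by (intro eventually_in_closed_family)
      (auto simp: continuous_on_def finite_range_normal_cone polyhedron_imp_closed
        intro!: closed_normal_cone_superset)
  then show ?thesis by eventually_elim auto
qed

text \<open>For \<open>y\<close> near \<open>x\<close> both multipliers lie in the normal cone at
  \<open>d x\<close>, so nondegeneracy at \<open>x\<close> applies to their difference. The factors
  2 and 3 come from \<open>perturbed_kkt_bounds\<close>.\<close>

lemma calm:
  assumes "x \<in> K"
  shows "\<forall>\<^sub>F y in at x within K. norm (u y - u x) \<le> 2 * (C + C / c) * norm (y - x) \<and>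
    norm (l y - l x) \<le> 3 * (C + C / c) / c * norm (y - x)"
proof -
  have "\<forall>\<^sub>F y in at x within K. y \<in> K"
    by (simp add: eventually_at_filter)
  with eventually_normal_cone_subset[OF assms] show ?thesis
  proof eventually_elim
    case (elim y)
    have "l y - l x \<in> span (normal_cone D (d x))"
      using elim multiplier_d[OF assms] multiplier_d[of y] by (intro span_diff span_base) auto
    then have nd: "c * norm (l y - l x) \<le> norm (adj (A x) (l y - l x))"
      using nondeg[OF assms] by (simp add: d_def)
    let ?r1 = "- ((F y - F x) + adj (A y - A x) (l y))"
    let ?r2 = "(G y - G x) + blinfun_apply (A y - A x) (u y)"
    have eq: "(u y - u x) + adj (A x) (l y - l x) = ?r1"
      using stationary_diff[OF assms elim(2)] by (auto simp: add_eq_0_iff algebra_simps)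
    note bnd = perturbed_kkt_bounds[OF eq diff_monotone[OF assms elim(2)] c_pos nd]
    have R: "norm ?r1 + norm ?r2 / c \<le> (C + C / c) * norm (y - x)"
      using perturbation_bounds[OF assms elim(2)] c_pos
      by (auto simp: distrib_right intro!: add_mono dest: divide_right_mono[of _ _ c])
    then have "3 * (norm ?r1 + norm ?r2 / c) / c \<le> 3 * ((C + C / c) * norm (y - x)) / c"
      using c_pos by (intro divide_right_mono) auto
    also have "\<dots> = 3 * (C + C / c) / c * norm (y - x)"
      by simp
    finally have "norm (l y - l x) \<le> 3 * (C + C / c) / c * norm (y - x)"
      by (rule order.trans[OF bnd(2)])
    moreover have "norm (u y - u x) \<le> 2 * (C + C / c) * norm (y - x)"
      unfolding mult.assoc by (rule order.trans[OF bnd(1)]) (intro mult_left_mono R, simp)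
    ultimately show ?case by blast
  qed
qed

definition Lu :: real where "Lu = 2 * (C + C / c)"

definition Ll :: real where "Ll = 3 * (C + C / c) / c"

lemma Lu_nonneg: "Lu \<ge> 0" and Ll_nonneg: "Ll \<ge> 0"
  using C_nonneg c_pos by (auto simp: Lu_def Ll_def)

lemma u_lipschitz: "Lu-lipschitz_on K u"
  by (rule lipschitz_on_of_calm[OF convex Lu_nonneg])
    (rule eventually_mono[OF calm], simp_all add: Lu_def)

lemma l_lipschitz: "Ll-lipschitz_on K l"
  by (rule lipschitz_on_of_calm[OF convex Ll_nonneg])
    (rule eventually_mono[OF calm], simp_all add: Ll_def)

text \<open>Every point of the graph of the normal cone mapping near \<open>(d x, l x)\<close> lies in a
  polyhedral piece \<open>{(e, m). m \<in> N \<and> N \<subseteq> normal_cone D e}\<close> that also contains \<open>(d x, l x)\<close>.\<close>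

lemma eventually_common_piece:
  assumes "x \<in> K"
  shows "\<forall>\<^sub>F y in at x within K.
    l x \<in> normal_cone D (d y) \<and> normal_cone D (d y) \<subseteq> normal_cone D (d x)"
proof -
  \<comment> \<open>To be used with \<open>S = normal_cone D (d y)\<close>, which contains
    \<open>l y\<close>; this relies on the continuity of \<open>l\<close> just established.\<close>
  have "\<forall>\<^sub>F y in at x within K. \<forall>S\<in>range (normal_cone D). l y \<in> S \<longrightarrow> l x \<in> S"
    using lipschitz_on_continuous_on[OF l_lipschitz] assms polyhedron
    by (intro eventually_in_closed_family)
      (auto simp: continuous_on_def finite_range_normal_cone closed_normal_cone)
  moreover have "\<forall>\<^sub>F y in at x within K. y \<in> K"
    by (simp add: eventually_at_filter)
  ultimately show ?thesis
    using eventually_normal_cone_subset[OF assms]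
    by eventually_elim (use multiplier_d in auto)
qed

text \<open>The combinations \<open>w\<close> and \<open>q\<close> of increments solve a perturbed
  KKT system at \<open>x\<close> whose residuals carry the small factor \<open>\<eta>\<close>.
  Monotonicity alone gives no sign for such a combination; on a common piece of the graph the
  pairing vanishes.\<close>

lemma extrapolation_estimate:
  assumes K: "x \<in> K" "y \<in> K" "z \<in> K" and z: "z = y + t *\<^sub>R (y - x)" "t > 0"
    and piece_x: "l x \<in> normal_cone D (d z)" "normal_cone D (d z) \<subseteq> normal_cone D (d x)"
    and piece_y: "l y \<in> normal_cone D (d z)" "normal_cone D (d z) \<subseteq> normal_cone D (d y)"
    and F: "norm ((F y - F x) - (F z - F y) /\<^sub>R t) \<le> \<eta> * norm (y - x)"
    and G: "norm ((G y - G x) - (G z - G y) /\<^sub>R t) \<le> \<eta> * norm (y - x)"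
    and A: "norm ((A y - A x) - (A z - A y) /\<^sub>R t) \<le> \<eta> * norm (y - x)"
    and near: "norm (z - x) \<le> \<eta>"
  defines "M \<equiv> 1 + \<bar>Bu\<bar> + \<bar>Bl\<bar> + LA * (Lu + Ll)"
  shows "norm ((u y - u x) - (u z - u y) /\<^sub>R t) \<le> 2 * (M + M / c) * (\<eta> * norm (y - x))"
proof -
  define s where "s = inverse t"
  define w where "w = (u y - u x) - s *\<^sub>R (u z - u y)"
  define q where "q = (l y - l x) - s *\<^sub>R (l z - l y)"
  define PF where "PF = (F y - F x) - s *\<^sub>R (F z - F y)"
  define PG where "PG = (G y - G x) - s *\<^sub>R (G z - G y)"
  define PA where "PA = (A y - A x) - s *\<^sub>R (A z - A y)"
  \<comment> \<open>The second system is differenced with base point \<open>z\<close>, so that the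
    variations of \<open>A\<close> in both systems act on the same \<open>l y\<close> and combine to
    \<open>PA\<close>. The last term pays for replacing \<open>A z\<close> by
    \<open>A x\<close>.\<close>
  define r1 where "r1 = - (PF + adj PA (l y) - adj (A z - A x) (s *\<^sub>R (l z - l y)))"
  define r2 where "r2 = PG + blinfun_apply PA (u y) -
    blinfun_apply (A z - A x) (s *\<^sub>R (u z - u y))"
  define h where "h = \<eta> * norm (y - x)"
  have h: "h \<ge> 0"
    using order.trans[OF norm_ge_zero near] by (simp add: h_def)
  have s: "s > 0" "s * norm (z - y) = norm (y - x)"
    using z by (auto simp: s_def)
  have eq: "w + adj (A x) q = r1"
  proof -
    have "adj PA (l y) = adj (A y - A x) (l y) - s *\<^sub>R (adj (A z) (l y) - adj (A y) (l y))"
      by (simp only: PA_def adj_diff_left adj_scaleR_left)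
    then have "w + adj (A x) q - r1 =
        ((u y - u x) + (F y - F x) + adj (A y - A x) (l y) + adj (A x) (l y - l x)) +
        s *\<^sub>R ((u y - u z) + (F y - F z) + adj (A y - A z) (l y) + adj (A z) (l y - l z))"
      by (simp add: w_def q_def r1_def PF_def adj_diff_left adj_right_simps algebra_simps)
    then show ?thesis
      by (simp only: stationary_diff[OF K(1,2)] stationary_diff[OF K(3,2)]) simp
  qed
  have "(d y - d x) - s *\<^sub>R (d z - d y) = blinfun_apply (A x) w + r2"
  proof -
    have "(d y - d x) - s *\<^sub>R (d z - d y) = (d y - d x) + s *\<^sub>R (d y - d z)"
      by (simp add: scaleR_diff_right)
    also have "\<dots> = blinfun_apply (A x) w + r2"
      unfolding d_diff[of y x] d_diff[of y z] w_def r2_def PG_def PA_def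
      by (simp add: blinfun.diff_left blinfun.diff_right blinfun.scaleR_left
          blinfun.scaleR_right scaleR_diff_right scaleR_add_right)
    finally show ?thesis .
  qed
  moreover have orth: "m \<bullet> d x = m \<bullet> d z" "m \<bullet> d y = m \<bullet> d z"
    if "m \<in> normal_cone D (d z)" for m
  proof -
    \<comment> \<open>A vector normal at both points is tested at each against the other, which
      gives both inequalities.\<close>
    have eq: "m \<bullet> d v = m \<bullet> d z" if "m \<in> normal_cone D (d v)" for v
      using that \<open>m \<in> normal_cone D (d z)\<close>
        normal_coneD[of m D "d v" "d z"] normal_coneD[of m D "d z" "d v"]
        normal_cone_memD[of m D "d v"] normal_cone_memD[of m D "d z"]
      by (simp add: inner_diff_right)
    show "m \<bullet> d x = m \<bullet> d z" "m \<bullet> d y = m \<bullet> d z"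
      using that piece_x(2) piece_y(2) by (auto intro!: eq)
  qed
  \<comment> \<open>\<open>q\<close> combines \<open>l x\<close>, \<open>l y\<close> and
    \<open>l z\<close>, all of which lie in the normal cone at \<open>d z\<close>.\<close>
  have "q \<bullet> ((d y - d x) - s *\<^sub>R (d z - d y)) = 0"
    using orth[OF piece_x(1)] orth[OF piece_y(1)] orth[OF multiplier_d[OF K(3)]]
    by (simp add: q_def inner_diff_left inner_diff_right)
  ultimately have mono: "0 \<le> q \<bullet> (blinfun_apply (A x) w + r2)"
    by simp
  have "q \<in> span (normal_cone D (d x))"
    using piece_x piece_y multiplier_d[OF K(3)] unfolding q_def
    by (intro span_diff span_scale span_base) auto
  then have nd: "c * norm q \<le> norm (adj (A x) q)"
    using nondeg[OF K(1)] by (simp add: d_def)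
  have PF: "norm PF \<le> h" and PG: "norm PG \<le> h" and PA: "norm PA \<le> h"
    using F G A by (simp_all add: PF_def PG_def PA_def h_def s_def)
  have dA: "norm (A z - A x) \<le> LA * \<eta>"
    using lipschitz_onD[OF A_lipschitz K(3,1)] mult_left_mono[OF near LA_nonneg]
    by (simp add: dist_norm)
  \<comment> \<open>The factor \<open>1 / t\<close> cancels against the length
    \<open>t * norm (y - x)\<close> of the step from \<open>y\<close> to \<open>z\<close>.\<close>
  have scaled: "norm (s *\<^sub>R (f z - f y)) \<le> L * norm (y - x)"
    if "L-lipschitz_on K f" for L and f :: "'a \<Rightarrow> 'v::real_normed_vector"
  proof -
    have "s * norm (f z - f y) \<le> s * (L * norm (z - y))"
      using lipschitz_onD[OF that K(3,2)] s(1) by (intro mult_left_mono) (auto simp: dist_norm)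
    then show ?thesis
      using s by (simp add: mult.left_commute[of s])
  qed
  note dl = scaled[OF l_lipschitz] and du = scaled[OF u_lipschitz]
  have "norm (adj PA (l y)) \<le> h * \<bar>Bl\<bar>"
    using PA l_bound[OF K(2)] h by (intro order.trans[OF norm_adj_le] mult_mono) auto
  moreover have "norm (adj (A z - A x) (s *\<^sub>R (l z - l y))) \<le> (LA * \<eta>) * (Ll * norm (y - x))"
    using dA dl by (intro order.trans[OF norm_adj_le] mult_mono) (auto intro: order.trans[OF norm_ge_zero])
  moreover have "norm r1 \<le> norm PF + norm (adj PA (l y)) +
      norm (adj (A z - A x) (s *\<^sub>R (l z - l y)))"
    unfolding r1_def norm_minus_cancel
    by (intro order.trans[OF norm_triangle_ineq4] add_mono norm_triangle_ineq order.refl)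
  ultimately have "norm r1 \<le> (1 + \<bar>Bl\<bar> + LA * Ll) * h"
    using PF by (simp add: h_def algebra_simps)
  also have "\<dots> \<le> M * h"
    using h Lu_nonneg LA_nonneg by (intro mult_right_mono) (auto simp: M_def algebra_simps)
  finally have r1: "norm r1 \<le> M * h" .
  have "norm (blinfun_apply PA (u y)) \<le> h * \<bar>Bu\<bar>"
    using PA u_bound[OF K(2)] h by (intro order.trans[OF norm_blinfun] mult_mono) auto
  moreover have "norm (blinfun_apply (A z - A x) (s *\<^sub>R (u z - u y))) \<le>
      (LA * \<eta>) * (Lu * norm (y - x))"
    using dA du by (intro order.trans[OF norm_blinfun] mult_mono) (auto intro: order.trans[OF norm_ge_zero])
  moreover have "norm r2 \<le> norm PG + norm (blinfun_apply PA (u y)) +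
      norm (blinfun_apply (A z - A x) (s *\<^sub>R (u z - u y)))"
    unfolding r2_def
    by (intro order.trans[OF norm_triangle_ineq4] add_mono norm_triangle_ineq order.refl)
  ultimately have "norm r2 \<le> (1 + \<bar>Bu\<bar> + LA * Lu) * h"
    using PG by (simp add: h_def algebra_simps)
  also have "\<dots> \<le> M * h"
    using h Ll_nonneg LA_nonneg by (intro mult_right_mono) (auto simp: M_def algebra_simps)
  finally have r2: "norm r2 \<le> M * h" .
  have "2 * (norm r1 + norm r2 / c) \<le> 2 * (M * h + M * h / c)"
    using r1 r2 c_pos by (intro mult_left_mono add_mono divide_right_mono) auto
  also have "\<dots> = 2 * (M + M / c) * h"
    by (simp add: distrib_right)
  finally have "2 * (norm r1 + norm r2 / c) \<le> 2 * (M + M / c) * h" .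
  with perturbed_kkt_bounds(1)[OF eq mono c_pos nd] show ?thesis
    by (simp add: w_def s_def h_def)
qed

text \<open>Including \<open>y = x\<close>, where \<open>multiplier_d\<close> gives the membership,
  permits composition with curves converging to \<open>x\<close>.\<close>

lemma eventually_common_piece_nhds:
  assumes "x \<in> interior K"
  shows "\<forall>\<^sub>F y in nhds x. y \<in> K \<and>
    l x \<in> normal_cone D (d y) \<and> normal_cone D (d y) \<subseteq> normal_cone D (d x)"
proof -
  have "x \<in> K"
    using assms interior_subset by blast
  then have "\<forall>\<^sub>F y in nhds x. l x \<in> normal_cone D (d y) \<and> normal_cone D (d y) \<subseteq> normal_cone D (d x)"
    using eventually_common_piece[of x] multiplier_d[of x]
    by (simp add: eventually_nhds_conv_at at_within_interior[OF assms])
  moreover have "\<forall>\<^sub>F y in nhds x. y \<in> K"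
    using assms by (simp add: eventually_nhds_in_nhd)
  ultimately show ?thesis
    by eventually_elim simp
qed

text \<open>The quotient \<open>(u z - u y) /\<^sub>R t\<close> approximates
  \<open>U (y - x)\<close> for small \<open>t\<close> and, by \<open>extrapolation_estimate\<close>,
  also \<open>u y - u x\<close>. Here \<open>r\<close> depends on \<open>x\<close> and
  \<open>e\<close> only, whereas \<open>t\<close> may depend on \<open>y\<close> and
  \<open>U\<close>.\<close>

lemma derivative_approximation:
  assumes x: "x \<in> interior K"
    and F: "strictly_differentiable_at F x" and G: "strictly_differentiable_at G x"
    and A: "strictly_differentiable_at A x" and "e > 0"
  shows "\<exists>r>0. \<forall>y\<in>ball x r. \<forall>U. (u has_derivative U) (at y) \<longrightarrow>
    norm (u y - u x - U (y - x)) \<le> e * norm (y - x)"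
proof -
  define M where "M = 1 + \<bar>Bu\<bar> + \<bar>Bl\<bar> + LA * (Lu + Ll)"
  have "M > 0"
    using Lu_nonneg Ll_nonneg LA_nonneg unfolding M_def
    by (intro add_pos_nonneg mult_nonneg_nonneg) auto
  define B where "B = 2 * (M + M / c)"
  \<comment> \<open>Half of \<open>e\<close> is for the extrapolation estimate with constant
    \<open>B\<close>, the other half for the differentiability of \<open>u\<close> at
    \<open>y\<close>.\<close>
  define \<eta> where "\<eta> = e / 2 / B"
  have "B > 0"
    using \<open>M > 0\<close> c_pos by (simp add: B_def add_pos_pos)
  then have "\<eta> > 0" and B\<eta>: "B * \<eta> = e / 2"
    using \<open>e > 0\<close> by (auto simp: \<eta>_def)
  obtain rF where rF: "rF > 0" "\<And>y t. \<lbrakk>y \<in> ball x rF; y + t *\<^sub>R (y - x) \<in> ball x rF; t > 0\<rbrakk> \<Longrightarrow>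
      norm ((F y - F x) - (F (y + t *\<^sub>R (y - x)) - F y) /\<^sub>R t) \<le> \<eta> * norm (y - x)"
    using strictly_differentiable_at_extrapolate[OF F \<open>\<eta> > 0\<close>] by blast
  obtain rG where rG: "rG > 0" "\<And>y t. \<lbrakk>y \<in> ball x rG; y + t *\<^sub>R (y - x) \<in> ball x rG; t > 0\<rbrakk> \<Longrightarrow>
      norm ((G y - G x) - (G (y + t *\<^sub>R (y - x)) - G y) /\<^sub>R t) \<le> \<eta> * norm (y - x)"
    using strictly_differentiable_at_extrapolate[OF G \<open>\<eta> > 0\<close>] by blast
  obtain rA where rA: "rA > 0" "\<And>y t. \<lbrakk>y \<in> ball x rA; y + t *\<^sub>R (y - x) \<in> ball x rA; t > 0\<rbrakk> \<Longrightarrow>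
      norm ((A y - A x) - (A (y + t *\<^sub>R (y - x)) - A y) /\<^sub>R t) \<le> \<eta> * norm (y - x)"
    using strictly_differentiable_at_extrapolate[OF A \<open>\<eta> > 0\<close>] by blast
  have "\<forall>\<^sub>F y in nhds x. y \<in> interior K"
    using x by (simp add: eventually_nhds_in_open)
  with eventually_common_piece_nhds[OF x]
  have "\<forall>\<^sub>F y in nhds x. y \<in> interior K \<and>
      l x \<in> normal_cone D (d y) \<and> normal_cone D (d y) \<subseteq> normal_cone D (d x)"
    by eventually_elim simp
  then obtain rK where rK: "rK > 0" "\<And>y. dist y x < rK \<Longrightarrow> y \<in> interior K \<and>
      l x \<in> normal_cone D (d y) \<and> normal_cone D (d y) \<subseteq> normal_cone D (d x)"
    unfolding eventually_nhds_metric by blast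
  \<comment> \<open>Including \<open>\<eta>\<close> secures
    \<open>norm (z - x) \<le> \<eta>\<close>, which controls \<open>A z - A x\<close>.\<close>
  define r where "r = Min {rF, rG, rA, rK, \<eta>}"
  have r: "r > 0" "r \<le> rF" "r \<le> rG" "r \<le> rA" "r \<le> rK" "r \<le> \<eta>"
    using rF(1) rG(1) rA(1) rK(1) \<open>\<eta> > 0\<close> by (auto simp: r_def)
  have "norm (u y - u x - U (y - x)) \<le> e * norm (y - x)"
    if y: "y \<in> ball x r" and U: "(u has_derivative U) (at y)" for y U
  proof -
    define z where "z t = y + t *\<^sub>R (y - x)" for t
    have "(z \<longlongrightarrow> y + 0 *\<^sub>R (y - x)) (at_right 0)"
      unfolding z_def by (intro tendsto_intros)
    then have z: "filterlim z (nhds y) (at_right 0)"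
      by simp
    have yK: "y \<in> interior K"
      using y r rK(2)[of y] by (simp add: dist_commute)
    obtain \<rho> where "\<rho> > 0" and \<rho>: "\<And>v. norm (v - y) < \<rho> \<Longrightarrow>
        norm (u v - u y - U (v - y)) \<le> e / 2 * norm (v - y)"
      using U \<open>e > 0\<close> unfolding has_derivative_at_alt by (metis half_gt_zero)
    have "\<forall>\<^sub>F t in at_right 0. z t \<in> ball y \<rho> \<inter> ball x r"
      using y \<open>\<rho> > 0\<close> by (intro topological_tendstoD[OF z]) auto
    moreover have "\<forall>\<^sub>F t in at_right 0. z t \<in> K \<and> l y \<in> normal_cone D (d (z t)) \<and>
        normal_cone D (d (z t)) \<subseteq> normal_cone D (d y)"
      using eventually_common_piece_nhds[OF yK] z by (rule eventually_compose_filterlim)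
    moreover have "\<forall>\<^sub>F t::real in at_right 0. t > 0"
      by (rule eventually_at_right_less)
    ultimately have "\<forall>\<^sub>F t in at_right 0. z t \<in> ball y \<rho> \<inter> ball x r \<and>
        (z t \<in> K \<and> l y \<in> normal_cone D (d (z t)) \<and>
        normal_cone D (d (z t)) \<subseteq> normal_cone D (d y)) \<and> t > 0"
      by eventually_elim simp
    then obtain t where t: "t > 0" "z t \<in> ball y \<rho>" "z t \<in> ball x r" "z t \<in> K"
      and pc: "l y \<in> normal_cone D (d (z t))" "normal_cone D (d (z t)) \<subseteq> normal_cone D (d y)"
      using eventually_happens' trivial_limit_at_right_real by blast
    have "norm ((u y - u x) - (u (z t) - u y) /\<^sub>R t) \<le> B * (\<eta> * norm (y - x))"
      unfolding B_def M_def
    proof (rule extrapolation_estimate)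
      show "x \<in> K" "y \<in> K"
        using x yK interior_subset by auto
      show "l x \<in> normal_cone D (d (z t))" "normal_cone D (d (z t)) \<subseteq> normal_cone D (d x)"
        using rK(2)[of "z t"] t(3) r by (auto simp: dist_commute)
      show "norm (z t - x) \<le> \<eta>"
        using t(3) r by (auto simp: dist_norm norm_minus_commute)
      show "norm ((F y - F x) - (F (z t) - F y) /\<^sub>R t) \<le> \<eta> * norm (y - x)"
        unfolding z_def by (rule rF) (use y t r in \<open>auto simp: z_def\<close>)
      show "norm ((G y - G x) - (G (z t) - G y) /\<^sub>R t) \<le> \<eta> * norm (y - x)"
        unfolding z_def by (rule rG) (use y t r in \<open>auto simp: z_def\<close>)
      show "norm ((A y - A x) - (A (z t) - A y) /\<^sub>R t) \<le> \<eta> * norm (y - x)"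
        unfolding z_def by (rule rA) (use y t r in \<open>auto simp: z_def\<close>)
    qed (use t pc in \<open>simp_all add: z_def\<close>)
    then have 1: "norm ((u y - u x) - (u (z t) - u y) /\<^sub>R t) \<le> e / 2 * norm (y - x)"
      using B\<eta> by (metis mult.assoc)
    have "norm (u (z t) - u y - U (z t - y)) \<le> e / 2 * norm (z t - y)"
      using t(2) by (intro \<rho>) (simp add: dist_norm norm_minus_commute)
    moreover have "U (z t - y) = t *\<^sub>R U (y - x)"
      by (simp only: z_def add_diff_cancel_left' linear_scale[OF has_derivative_linear[OF U]])
    then have "u (z t) - u y - U (z t - y) = t *\<^sub>R ((u (z t) - u y) /\<^sub>R t - U (y - x))"
      using t(1) by (simp add: scaleR_diff_right)
    ultimately have 2: "norm ((u (z t) - u y) /\<^sub>R t - U (y - x)) \<le> e / 2 * norm (y - x)"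
      using t(1) by (simp add: z_def)
    show ?thesis
      using norm_triangle_ineq[of "(u y - u x) - (u (z t) - u y) /\<^sub>R t"
          "(u (z t) - u y) /\<^sub>R t - U (y - x)"] 1 2 by simp
  qed
  then show ?thesis
    using r(1) by blast
qed

end

section \<open>G-semismoothness\<close>

text \<open>The estimate at points of differentiability survives limits of derivatives and is convex
  in \<open>V\<close>, so it extends from derivatives to the Bouligand subdifferential and then to
  its convex hull.\<close>

lemma G_semismooth_atI:
  fixes H :: "'a::real_normed_vector \<Rightarrow> 'b::real_normed_vector"
  assumes "open \<Omega>" "x \<in> \<Omega>" "L-lipschitz_on \<Omega> H"
    and approx: "\<And>e. e > 0 \<Longrightarrow> \<exists>r>0. \<forall>y\<in>ball x r. \<forall>U. (H has_derivative U) (at y) \<longrightarrow>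
      norm (H y - H x - U (y - x)) \<le> e * norm (y - x)"
  shows "G_semismooth_at \<Omega> H x"
  unfolding G_semismooth_at_def G_semismooth_wrt_def
proof (intro conjI allI impI assms(1,2))
  show "locally_lipschitz_on \<Omega> H"
    unfolding locally_lipschitz_on_def
    using assms(3) by (meson inf_le1 lipschitz_on_subset zero_less_one)
  show cont: "continuous_on \<Omega> H"
    by (rule lipschitz_on_continuous_on[OF assms(3)])
  fix e :: real assume "e > 0"
  then obtain r where "r > 0" and r: "\<And>y U. \<lbrakk>y \<in> ball x r; (H has_derivative U) (at y)\<rbrakk> \<Longrightarrow>
      norm (H y - H x - U (y - x)) \<le> e * norm (y - x)"
    using approx by blast
  have "norm (H (x + h) - H x - blinfun_apply V h) \<le> e * norm h"
    if h: "x + h \<in> ball x r" "x + h \<in> \<Omega>" and V: "V \<in> clarke_jacobian H (x + h)" for h V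
  proof -
    \<comment> \<open>The desired estimate for \<open>V\<close>, written as the preimage of a convex
      set under the linear map \<open>V \<mapsto> V h\<close>.\<close>
    let ?S = "{V. blinfun_apply V h \<in> cball (H (x + h) - H x) (e * norm h)}"
    have "convex ?S"
      using convex_linear_vimage[of "\<lambda>V. blinfun_apply V h" "cball (H (x + h) - H x) (e * norm h)"]
      by (auto simp: vimage_def blinfun.add_left blinfun.scaleR_left linear_iff)
    moreover have "bouligand_subdiff H (x + h) \<subseteq> ?S"
    proof
      fix V assume "V \<in> bouligand_subdiff H (x + h)"
      then obtain y :: "nat \<Rightarrow> 'a" and W where y: "y \<longlonglongrightarrow> x + h" and W: "W \<longlonglongrightarrow> V"
        and der: "\<And>k. (H has_derivative blinfun_apply (W k)) (at (y k))"
        unfolding bouligand_subdiff_def by blast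
      have "isCont H (x + h)"
        using cont h(2) assms(1) by (simp add: continuous_on_eq_continuous_at)
      then have "(\<lambda>k. H (y k)) \<longlonglongrightarrow> H (x + h)"
        using y by (rule isCont_tendsto_compose)
      then have "(\<lambda>k. norm (H (y k) - H x - blinfun_apply (W k) (y k - x))) \<longlonglongrightarrow>
          norm (H (x + h) - H x - blinfun_apply V (x + h - x))"
        by (intro tendsto_intros y W)
      moreover have "(\<lambda>k. e * norm (y k - x)) \<longlonglongrightarrow> e * norm (x + h - x)"
        by (intro tendsto_intros y)
      moreover have "\<forall>\<^sub>F k in sequentially.
          norm (H (y k) - H x - blinfun_apply (W k) (y k - x)) \<le> e * norm (y k - x)"
        using topological_tendstoD[OF y open_ball h(1)] by eventually_elim (use r der in blast)
      ultimately have "norm (H (x + h) - H x - blinfun_apply V (x + h - x)) \<le> e * norm (x + h - x)"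
        by (intro tendsto_le[OF sequentially_bot])
      then show "V \<in> ?S"
        by (simp add: dist_norm)
    qed
    ultimately have "clarke_jacobian H (x + h) \<subseteq> ?S"
      unfolding clarke_jacobian_def by (rule hull_minimal[rotated])
    with V show ?thesis
      by (auto simp: dist_norm)
  qed
  moreover have "\<forall>\<^sub>F h in nhds 0. x + h \<in> ball x r"
    unfolding eventually_nhds_metric using \<open>r > 0\<close> by (auto simp: dist_norm)
  ultimately show "\<forall>\<^sub>F h in nhds 0. x + h \<in> \<Omega> \<longrightarrow> (\<forall>V\<in>clarke_jacobian H (x + h).
      norm (H (x + h) - H x - blinfun_apply V h) \<le> e * norm h)"
    by (auto elim: eventually_mono)
qed

section \<open>The subproblem\<close>

text \<open>The objective gap between \<open>v\<close> and \<open>u\<close> is exactly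
  \<open>(u + F x) \<bullet> (v - u)\<close> plus half the squared distance, and stationarity
  together with the normal cone condition makes the first term nonnegative.\<close>

lemma qp_solution_of_multiplier:
  fixes G :: "'a::euclidean_space \<Rightarrow> 'b::euclidean_space"
  assumes lin: "linear (jac G x)" and "qp_multiplier F G D x u l"
  shows "qp_solution F G D x u"
proof -
  have l: "l \<in> normal_cone D (G x + jac G x u)" and st: "u + F x + nabla G x l = 0"
    using assms(2) by (auto simp: qp_multiplier_def)
  have "1 / 2 * (norm u)\<^sup>2 + F x \<bullet> u \<le> 1 / 2 * (norm v)\<^sup>2 + F x \<bullet> v"
    if v: "G x + jac G x v \<in> D" for v
  proof -
    have "(u + F x) \<bullet> (v - u) = - (nabla G x l \<bullet> (v - u))"
      using st by (metis add_eq_0_iff2 inner_minus_left)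
    also have "\<dots> = - (l \<bullet> ((G x + jac G x v) - (G x + jac G x u)))"
      using adjoint_works[OF lin] by (simp add: linear_diff[OF lin] inner_commute)
    also have "\<dots> \<ge> 0"
      using normal_coneD[OF l v] by simp
    finally have "0 \<le> (u + F x) \<bullet> (v - u) + 1 / 2 * (norm (v - u))\<^sup>2"
      by simp
    also have "\<dots> = (1 / 2 * (norm v)\<^sup>2 + F x \<bullet> v) - (1 / 2 * (norm u)\<^sup>2 + F x \<bullet> u)"
      by (simp add: power2_norm_eq_inner algebra_simps inner_commute)
    finally show ?thesis by simp
  qed
  then show ?thesis
    using normal_cone_memD[OF l] by (auto simp: qp_solution_def is_arg_min_def not_less)
qed

text \<open>The difference of two multipliers lies in the span of the normal cone and in the kernel
  of the adjoint Jacobian.\<close>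

lemma multiplier_unique:
  fixes G :: "'a::euclidean_space \<Rightarrow> 'b::euclidean_space"
  assumes lin: "linear (jac G x)" and nd: "nondegenerate G D \<gamma> x (G x + jac G x u)"
    and "qp_multiplier F G D x u l" "qp_multiplier F G D x u m"
  shows "l = m"
proof -
  have "nabla G x l = nabla G x m"
    using assms(3,4) by (simp add: qp_multiplier_def) (metis add_left_imp_eq)
  then have "nabla G x (l - m) = 0"
    by (simp add: linear_diff[OF adjoint_linear[OF lin]])
  moreover have "l - m \<in> span (normal_cone D (G x + jac G x u))"
    using assms(3,4) by (intro span_diff span_base) (auto simp: qp_multiplier_def)
  ultimately show ?thesis
    using nd by (force simp: nondegenerate_def mult_le_0_iff)
qed

theorem proposition4p1:
  fixes F :: "real ^ 'n \<Rightarrow> real ^ 'n" and G :: "real ^ 'n \<Rightarrow> real ^ 's"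
    and D :: "(real ^ 's) set" and xb :: "real ^ 'n" and \<gamma> \<omega> :: real
  assumes "C1_map F"
    and "C2_map G"
    and "polyhedron D"
    and "solves_GE F G D xb"
    and "nondegenerate G D \<gamma> xb (G xb)"
    and "good_radius F G D xb \<gamma> \<omega>"
  shows "(\<forall>x \<in> cball xb \<omega>. is_singleton (S_set F G D x) \<and> is_singleton (Lambda_set F G D x))
    \<and> (\<exists>L. L-lipschitz_on (cball xb \<omega>) (S_map F G D))
    \<and> (\<exists>L. L-lipschitz_on (cball xb \<omega>) (Lambda_map F G D))
    \<and> (\<forall>x \<in> interior (cball xb \<omega>). G_semismooth_at (interior (cball xb \<omega>)) (S_map F G D) x)"
proof -
  let ?K = "cball xb \<omega>"
  obtain A where A: "\<And>x. (G has_derivative blinfun_apply (A x)) (at x)" and "C1_map A"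
    using assms(2) unfolding C2_map_def by blast
  have jac: "jac G x = blinfun_apply (A x)" for x
    using frechet_derivative_at[OF A] by simp
  have lin: "linear (jac G x)" for x
    unfolding jac by (intro bounded_linear.linear blinfun.bounded_linear_right)
  have "C1_map G"
    unfolding C1_map_def
  proof (intro exI[of _ A] conjI allI A)
    obtain A' where "\<And>x. (A has_derivative blinfun_apply (A' x)) (at x)"
      using \<open>C1_map A\<close> unfolding C1_map_def by blast
    then show "continuous_on UNIV A"
      by (intro continuous_at_imp_continuous_on ballI has_derivative_continuous)
  qed
  obtain \<beta>u \<beta>l where pos: "\<beta>u > 0" "\<beta>l > 0" and ex: "\<forall>x\<in>?K. \<exists>u l.
      (\<forall>v. qp_solution F G D x v \<longleftrightarrow> v = u) \<and> qp_multiplier F G D x u l \<and>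
      norm u \<le> \<beta>u * norm (x - xb) \<and>
      norm (l - base_multiplier F G D xb) \<le> \<beta>l * norm (x - xb) \<and>
      nondegenerate G D (\<gamma> / 2) x (G x + jac G x u)"
    using assms(6) unfolding good_radius_def Let_def
    by (elim conjE exE) (rule that, assumption, assumption, rule ballI, drule (1) bspec,
      elim exE conjE, intro exI conjI, assumption+)
  \<comment> \<open>The axiom of choice turns the pointwise solutions and multipliers into functions
    on the ball, identified below with \<open>S_map\<close> and \<open>Lambda_map\<close>.\<close>
  obtain u where "\<forall>x\<in>?K. \<exists>l.
      (\<forall>v. qp_solution F G D x v \<longleftrightarrow> v = u x) \<and> qp_multiplier F G D x (u x) l \<and>
      norm (u x) \<le> \<beta>u * norm (x - xb) \<and>
      norm (l - base_multiplier F G D xb) \<le> \<beta>l * norm (x - xb) \<and>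
      nondegenerate G D (\<gamma> / 2) x (G x + jac G x (u x))"
    using bchoice[OF ex] by (rule exE)
  from bchoice[OF this] obtain l where ul: "\<forall>x\<in>?K.
      (\<forall>v. qp_solution F G D x v \<longleftrightarrow> v = u x) \<and> qp_multiplier F G D x (u x) (l x) \<and>
      norm (u x) \<le> \<beta>u * norm (x - xb) \<and>
      norm (l x - base_multiplier F G D xb) \<le> \<beta>l * norm (x - xb) \<and>
      nondegenerate G D (\<gamma> / 2) x (G x + jac G x (u x))"
    by (rule exE)
  note ul = ul[rule_format]
  have S: "S_set F G D x = {u x}" if "x \<in> ?K" for x
  proof -
    \<comment> \<open>Every such \<open>u\<close> solves the subproblem and therefore equals its
      only solution \<open>u x\<close>.\<close>
    have "S_set F G D x = {u. \<exists>l. qp_multiplier F G D x u l}"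
      by (auto simp: S_set_def qp_multiplier_def image_iff)
    then show ?thesis
      using ul[OF that] qp_solution_of_multiplier[OF lin, of F D x] by auto
  qed
  have \<Lambda>: "Lambda_set F G D x = {l x}" if "x \<in> ?K" for x
    using ul[OF that] multiplier_unique[OF lin, of D "\<gamma> / 2" x "u x" F]
    by (auto simp: Lambda_set_def)
  have Sm: "S_map F G D x = u x" and \<Lambda>m: "Lambda_map F G D x = l x" if "x \<in> ?K" for x
    using S[OF that] \<Lambda>[OF that] by (simp_all add: S_map_def Lambda_map_def)
  obtain LF where LF: "LF-lipschitz_on ?K F"
    using C1_map_lipschitz_on[OF assms(1) compact_cball convex_cball] .
  obtain LG where LG: "LG-lipschitz_on ?K G"
    using C1_map_lipschitz_on[OF \<open>C1_map G\<close> compact_cball convex_cball] .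
  obtain LA where LA: "LA-lipschitz_on ?K A"
    using C1_map_lipschitz_on[OF \<open>C1_map A\<close> compact_cball convex_cball] .
  \<comment> \<open>The modulus \<open>\<gamma> / 2\<close> is the one guaranteed on the whole ball;
    the bounds come from the linear estimates with
    \<open>norm (x - xb) \<le> \<omega>\<close>.\<close>
  interpret kkt_family F G A D ?K "S_map F G D" "Lambda_map F G D" "\<gamma> / 2" LF LG LA
    "\<beta>u * \<omega>" "norm (base_multiplier F G D xb) + \<beta>l * \<omega>"
  proof
    show "\<gamma> / 2 > 0"
      using assms(5) by (simp add: nondegenerate_def)
    fix x assume x: "x \<in> ?K"
    have norm_x: "norm (x - xb) \<le> \<omega>"
      using x by (simp add: dist_norm norm_minus_commute)
    note * = ul[OF x] Sm[OF x] \<Lambda>m[OF x]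
    show "S_map F G D x + F x + adj (A x) (Lambda_map F G D x) = 0"
      "Lambda_map F G D x \<in> normal_cone D (G x + blinfun_apply (A x) (S_map F G D x))"
      using * by (auto simp: qp_multiplier_def jac)
    show "\<gamma> / 2 * norm m \<le> norm (adj (A x) m)"
      if "m \<in> span (normal_cone D (G x + blinfun_apply (A x) (S_map F G D x)))" for m
      using * that by (auto simp: nondegenerate_def jac)
    have "\<beta>u * norm (x - xb) \<le> \<beta>u * \<omega>" "\<beta>l * norm (x - xb) \<le> \<beta>l * \<omega>"
      using norm_x pos by (simp_all only: mult_le_cancel_left_pos)
    then show "norm (S_map F G D x) \<le> \<beta>u * \<omega>"
      "norm (Lambda_map F G D x) \<le> norm (base_multiplier F G D xb) + \<beta>l * \<omega>"
      using * norm_triangle_sub[of "l x" "base_multiplier F G D xb"]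
      unfolding Sm[OF x] \<Lambda>m[OF x] by linarith+
  qed (use assms(3) LF LG LA in auto)
  have "G_semismooth_at (interior ?K) (S_map F G D) x" if x: "x \<in> interior ?K" for x
    by (intro G_semismooth_atI[OF open_interior x lipschitz_on_subset[OF u_lipschitz interior_subset]]
        derivative_approximation[OF x] C1_map_strictly_differentiable_at assms(1)
        \<open>C1_map G\<close> \<open>C1_map A\<close>)
  then show ?thesis
    using S \<Lambda> u_lipschitz l_lipschitz by (auto simp: is_singleton_def)
qed

end
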